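(* Let $S$ be a semigroup that satisfies Property (C$_3$). If for infinitely many $n\ge 2$, $S$ satisfies the identity $$x^k y_1^k y_2^k\cdots y_n^k x^k\approx x^k y_n^k y_{n-1}^k\cdots y_1^k x^k$$ for some $k\ge 2$, where $x,y_1,\dots,y_n$ are distinct variables, then $S$ is non-finitely based.
   Context: Let $\mathfrak A$ be a countably infinite alphabet of variables; elements of the free semigroup $\mathfrak A^+$ are called words. An identity is a formal equality $\mathbf u\approx\mathbf v$ of words; a semigroup $S$ satisfies it if $\mathbf u$ and $\mathbf v$ take equal values under every assignment of elements of $S$ to the variables. $S$ is finitely based if there is a finite subset of its identities from which all its identities can be deduced; otherwise $S$ is non-finitely based. Two words have the same type if one can be obtained from the other by changing the individual exponents of variables, i.e. they can be written as $c_1^{u_1}\cdots c_r^{u_r}$ and $c_1^{v_1}\cdots c_r^{v_r}$ with variables $c_i\neq c_{i+1}$ and all $u_i,v_i\ge 1$. An island formed by a variable $x$ in a word $\mathbf u$ is a maximal (contiguous) subword of $\mathbf u$ that is a power of $x$. The height of a word over a two-letter alphabet is its number of islands. For $\ell\ge 2$, a semigroup $S$ satisfies Property (C$_\ell$) if for every word $\mathbf u\in\{x,y\}^+$ ($x,y$ distinct variables) of height at most $\ell$, whenever $S$ satisfies an identity $\mathbf u\approx\mathbf v$, the word $\mathbf v$ has the same type as $\mathbf u$. *)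

theory Defs
  imports Main
begin

text \<open>
  Variables are natural numbers, and the elements of the free semigroup over them are the
  nonempty lists; an identity is a pair of nonempty words. A semigroup is given by its
  multiplication on a type, with associativity expressed by the locale predicate
  \<^locale>\<open>semigroup\<close>.
\<close>

type_synonym word = "nat list"

text \<open>The value of the empty list is left unspecified; it is never used on words.\<close>

fun word_value :: "('a \<Rightarrow> 'a \<Rightarrow> 'a) \<Rightarrow> (nat \<Rightarrow> 'a) \<Rightarrow> word \<Rightarrow> 'a" where
  "word_value mult \<phi> [x] = \<phi> x"
| "word_value mult \<phi> (x # y # w) = mult (\<phi> x) (word_value mult \<phi> (y # w))"

definition satisfies_identity :: "('a \<Rightarrow> 'a \<Rightarrow> 'a) \<Rightarrow> word \<Rightarrow> word \<Rightarrow> bool" where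
  "satisfies_identity mult u v \<longleftrightarrow>
     u \<noteq> [] \<and> v \<noteq> [] \<and> (\<forall>\<phi>. word_value mult \<phi> u = word_value mult \<phi> v)"

definition subst_word :: "(nat \<Rightarrow> word) \<Rightarrow> word \<Rightarrow> word" where
  "subst_word \<sigma> w = concat (map \<sigma> w)"

text \<open>Equational deduction for semigroup identities. Associativity is built into words.\<close>

inductive deducible :: "(word \<times> word) set \<Rightarrow> word \<Rightarrow> word \<Rightarrow> bool" for \<Sigma> where
  basis: "(u, v) \<in> \<Sigma> \<Longrightarrow> deducible \<Sigma> u v"
| refl: "w \<noteq> [] \<Longrightarrow> deducible \<Sigma> w w"
| sym: "deducible \<Sigma> u v \<Longrightarrow> deducible \<Sigma> v u"
| trans: "deducible \<Sigma> u v \<Longrightarrow> deducible \<Sigma> v w \<Longrightarrow> deducible \<Sigma> u w"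
| mult: "deducible \<Sigma> u v \<Longrightarrow> deducible \<Sigma> u' v' \<Longrightarrow> deducible \<Sigma> (u @ u') (v @ v')"
| subst: "deducible \<Sigma> u v \<Longrightarrow> (\<And>x. \<sigma> x \<noteq> []) \<Longrightarrow>
    deducible \<Sigma> (subst_word \<sigma> u) (subst_word \<sigma> v)"

definition finitely_based :: "('a \<Rightarrow> 'a \<Rightarrow> 'a) \<Rightarrow> bool" where
  "finitely_based mult \<longleftrightarrow>
     (\<exists>\<Sigma>. finite \<Sigma> \<and> (\<forall>(u, v) \<in> \<Sigma>. satisfies_identity mult u v) \<and>
       (\<forall>u v. satisfies_identity mult u v \<longrightarrow> deducible \<Sigma> u v))"

text \<open>\<^term>\<open>power_product cs es\<close> is the word \<open>c\<^sub>1\<^bsup>e\<^sub>1\<^esup> \<dots> c\<^sub>r\<^bsup>e\<^sub>r\<^esup>\<close>.\<close>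

definition power_product :: "nat list \<Rightarrow> nat list \<Rightarrow> word" where
  "power_product cs es = concat (map2 (\<lambda>c e. replicate e c) cs es)"

definition same_type :: "word \<Rightarrow> word \<Rightarrow> bool" where
  "same_type u v \<longleftrightarrow>
     (\<exists>cs us vs. distinct_adj cs \<and> length us = length cs \<and> length vs = length cs \<and>
        (\<forall>e \<in> set us. e \<ge> 1) \<and> (\<forall>e \<in> set vs. e \<ge> 1) \<and>
        u = power_product cs us \<and> v = power_product cs vs)"

text \<open>
  An occurrence of a nonempty contiguous subword of \<open>w\<close> is encoded by the pair \<open>(i, j)\<close> of its
  start (inclusive) and end (exclusive) positions, so that different islands of \<open>w\<close>
  that are equal as words are counted separately.
\<close>

definition power_occurrence :: "word \<Rightarrow> nat \<Rightarrow> nat \<Rightarrow> bool" where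
  "power_occurrence w i j \<longleftrightarrow> i < j \<and> j \<le> length w \<and> (\<exists>x. \<forall>k \<in> {i..<j}. w ! k = x)"

definition islands :: "word \<Rightarrow> (nat \<times> nat) set" where
  "islands w = {(i, j). power_occurrence w i j \<and>
     (\<forall>i' j'. power_occurrence w i' j' \<and> i' \<le> i \<and> j \<le> j' \<longrightarrow> i' = i \<and> j' = j)}"

definition height :: "word \<Rightarrow> nat" where
  "height w = card (islands w)"

definition property_C :: "nat \<Rightarrow> ('a \<Rightarrow> 'a \<Rightarrow> 'a) \<Rightarrow> bool" where
  "property_C l mult \<longleftrightarrow>
     (\<forall>x y u v. x \<noteq> y \<and> u \<noteq> [] \<and> set u \<subseteq> {x, y} \<and> height u \<le> l \<and>
        satisfies_identity mult u v \<longrightarrow> same_type u v)"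

text \<open>
  \<^term>\<open>framed_powers k x [y\<^sub>1, y\<^sub>2]\<close> is the word \<open>x\<^bsup>k\<^esup> y\<^sub>1\<^bsup>k\<^esup> y\<^sub>2\<^bsup>k\<^esup> x\<^bsup>k\<^esup>\<close>,
  and likewise for longer lists.
\<close>

definition framed_powers :: "nat \<Rightarrow> nat \<Rightarrow> nat list \<Rightarrow> word" where
  "framed_powers k x ys = replicate k x @ concat (map (replicate k) ys) @ replicate k x"

end

theory Submission
  imports Defs
begin

text \<open>
  Let \<open>U = 0\<^sup>k 1\<^sup>k \<dots> n\<^sup>k 0\<^sup>k\<close>. If \<open>S\<close> satisfies \<open>U \<approx> w\<close>, then for every interval \<open>A \<subseteq> {1..n}\<close> sending
  the letters of \<open>A\<close> to \<open>1\<close> and the other letters to \<open>0\<close> turns \<open>U\<close> into a word of height 3, so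
  by (C\<open>\<^sub>3\<close>) the letters of \<open>A\<close> also occupy a contiguous block of \<open>w\<close>. Hence the nonzero letters of \<open>w\<close>
  occur in increasing or in decreasing order. An identity \<open>s \<approx> t\<close> of \<open>S\<close> in fewer than \<open>n\<close> variables
  cannot take an increasing word \<open>a \<sigma>(s) b\<close> to a decreasing word \<open>a \<sigma>(t) b\<close>: the contexts \<open>a\<close>, \<open>b\<close>
  could contain only zeros, so by the pigeonhole principle some \<open>\<sigma>(z)\<close> with \<open>z\<close> in \<open>s\<close> would contain two
  different nonzero letters; as \<open>z\<close> occurs in \<open>t\<close> too, \<open>\<sigma>(z)\<close> is a factor of both words, which
  is absurd. So a basis with fewer than \<open>n\<close> variables in each identity does not yield
  the reversal of \<open>U\<close>.
\<close>

section \<open>Evaluation of words and substitutions\<close>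

lemma subst_word_append: "subst_word \<sigma> (u @ v) = subst_word \<sigma> u @ subst_word \<sigma> v"
  by (simp add: subst_word_def)

lemma subst_word_subst_word:
  "subst_word \<tau> (subst_word \<sigma> w) = subst_word (\<lambda>x. subst_word \<tau> (\<sigma> x)) w"
  by (induction w) (auto simp: subst_word_def)

lemma subst_word_map: "subst_word (\<lambda>x. [f x]) w = map f w"
  by (induction w) (auto simp: subst_word_def)

lemma subst_word_neq_Nil: "w \<noteq> [] \<Longrightarrow> (\<And>x. \<sigma> x \<noteq> []) \<Longrightarrow> subst_word \<sigma> w \<noteq> []"
  by (cases w) (auto simp: subst_word_def)

lemma set_subst_word: "set (subst_word \<sigma> w) = (\<Union>z\<in>set w. set (\<sigma> z))"
  by (simp add: subst_word_def)

lemma subst_word_factor: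
  assumes "z \<in> set w"
  obtains p q where "subst_word \<sigma> w = p @ \<sigma> z @ q"
proof -
  from assms obtain l r where "w = l @ z # r"
    by (auto simp: in_set_conv_decomp)
  then have "subst_word \<sigma> w = subst_word \<sigma> l @ \<sigma> z @ subst_word \<sigma> r"
    by (simp add: subst_word_def)
  then show thesis by (rule that)
qed

lemma word_value_Cons:
  "w \<noteq> [] \<Longrightarrow> word_value mult \<phi> (x # w) = mult (\<phi> x) (word_value mult \<phi> w)"
  by (cases w) auto

lemma word_value_append:
  assumes "semigroup mult" "u \<noteq> []" "v \<noteq> []"
  shows "word_value mult \<phi> (u @ v) = mult (word_value mult \<phi> u) (word_value mult \<phi> v)"
  using assms(2)
proof (induction u rule: list_nonempty_induct)
  case (single x)
  then show ?case using assms(3) by (simp add: word_value_Cons)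
next
  case (cons x xs)
  then show ?case by (simp add: word_value_Cons semigroup.assoc[OF assms(1)])
qed

lemma word_value_subst_word:
  assumes "semigroup mult" "\<And>x. \<sigma> x \<noteq> []" "w \<noteq> []"
  shows "word_value mult \<phi> (subst_word \<sigma> w) = word_value mult (\<lambda>x. word_value mult \<phi> (\<sigma> x)) w"
  using assms(3)
proof (induction w rule: list_nonempty_induct)
  case (single x)
  then show ?case by (simp add: subst_word_def)
next
  case (cons x xs)
  have "subst_word \<sigma> (x # xs) = \<sigma> x @ subst_word \<sigma> xs"
    by (simp add: subst_word_def)
  with cons show ?case
    by (simp add: word_value_append[OF assms(1)] assms(2) subst_word_neq_Nil word_value_Cons)
qed

lemma satisfies_identity_sym:
  "satisfies_identity mult u v \<Longrightarrow> satisfies_identity mult v u"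
  by (simp add: satisfies_identity_def)

lemma satisfies_identity_trans:
  "satisfies_identity mult u v \<Longrightarrow> satisfies_identity mult v w \<Longrightarrow> satisfies_identity mult u w"
  by (simp add: satisfies_identity_def)

lemma satisfies_identity_append:
  assumes "semigroup mult" "satisfies_identity mult u v" "satisfies_identity mult u' v'"
  shows "satisfies_identity mult (u @ u') (v @ v')"
  using assms by (simp add: satisfies_identity_def word_value_append)

text \<open>The contexts \<open>a\<close> and \<open>b\<close> may be empty, whereas the empty list
  takes part in no identity; hence the case distinctions.\<close>

lemma satisfies_identity_context:
  assumes "semigroup mult" "satisfies_identity mult u v"
  shows "satisfies_identity mult (a @ u @ b) (a @ v @ b)"
proof -
  have refl: "satisfies_identity mult w w" if "w \<noteq> []" for w
    using that by (simp add: satisfies_identity_def)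
  have "satisfies_identity mult (u @ b) (v @ b)"
    using assms refl satisfies_identity_append by (cases "b = []") fastforce+
  then show ?thesis
    using assms(1) refl satisfies_identity_append by (cases "a = []") fastforce+
qed

lemma satisfies_identity_subst_word:
  assumes "semigroup mult" "satisfies_identity mult u v" "\<And>x. \<sigma> x \<noteq> []"
  shows "satisfies_identity mult (subst_word \<sigma> u) (subst_word \<sigma> v)"
  using assms by (simp add: satisfies_identity_def word_value_subst_word subst_word_neq_Nil)

text \<open>Renaming or identifying letters is a substitution by one-letter words; this is how
  identities are projected to two letters.\<close>

lemma satisfies_identity_map:
  assumes "semigroup mult" "satisfies_identity mult u v"
  shows "satisfies_identity mult (map f u) (map f v)"
  using satisfies_identity_subst_word[OF assms, of "\<lambda>x. [f x]"] by (simp add: subst_word_map)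

section \<open>Types and heights\<close>

lemma remdups_adj_replicate_append:
  assumes "e \<ge> 1" "w = [] \<or> hd w \<noteq> c"
  shows "remdups_adj (replicate e c @ w) = c # remdups_adj w"
  using assms(1)
proof (induction e rule: nat_induct_at_least)
  case base
  then show ?case using assms(2) by (cases w) auto
next
  case (Suc e)
  then show ?case by (cases e) auto
qed

lemma hd_power_product:
  assumes "length es = length cs" "\<forall>e \<in> set es. e \<ge> 1" "cs \<noteq> []"
  shows "power_product cs es \<noteq> [] \<and> hd (power_product cs es) = hd cs"
  using assms by (cases cs; cases es) (auto simp: power_product_def Suc_le_eq)

text \<open>Positive exponents keep every block and \<open>distinct_adj\<close> prevents
  neighbouring blocks from merging. So \<open>remdups_adj\<close> computes the type of a
  word.\<close>

lemma remdups_adj_power_product: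
  assumes "distinct_adj cs" "length es = length cs" "\<forall>e \<in> set es. e \<ge> 1"
  shows "remdups_adj (power_product cs es) = cs"
  using assms
proof (induction cs arbitrary: es)
  case Nil
  then show ?case by (simp add: power_product_def)
next
  case (Cons c cs)
  then obtain e es' where es: "es = e # es'" "length es' = length cs"
    by (cases es) auto
  have split: "power_product (c # cs) (e # es') = replicate e c @ power_product cs es'"
    by (simp add: power_product_def)
  have "power_product cs es' = [] \<or> hd (power_product cs es') \<noteq> c"
  proof (cases "cs = []")
    case True
    then show ?thesis by (simp add: power_product_def)
  next
    case False
    then show ?thesis
      using Cons.prems es hd_power_product[of es' cs] by (cases cs) (auto simp: distinct_adj_Cons)
  qed
  moreover have "distinct_adj cs"
    using Cons.prems(1) by (auto simp: distinct_adj_Cons)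
  ultimately show ?case
    using Cons.IH[of es'] Cons.prems by (simp add: es split remdups_adj_replicate_append)
qed

lemma same_type_remdups_adj: "same_type u v \<Longrightarrow> remdups_adj u = remdups_adj v"
  by (auto simp: same_type_def remdups_adj_power_product)

text \<open>Peels off the first island; iterated, it recovers the block structure of a word from its
  type.\<close>

lemma remdups_adj_eq_ConsE:
  assumes "remdups_adj w = c # cs"
  obtains e w' where "w = replicate e c @ w'" "remdups_adj w' = cs"
proof -
  from assms obtain r where w: "w = c # r"
    by (metis hd_remdups_adj list.exhaust_sel list.sel(1) remdups_adj.simps(1))
  define e where "e = length (takeWhile (\<lambda>y. y = c) r)"
  have "takeWhile (\<lambda>y. y = c) r = replicate e c"
    unfolding e_def by (rule replicate_eqI) (auto dest: set_takeWhileD)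
  then have "w = replicate (Suc e) c @ dropWhile (\<lambda>y. y = c) r"
    using takeWhile_dropWhile_id[of "\<lambda>y. y = c" r] by (simp add: w)
  moreover have "remdups_adj (dropWhile (\<lambda>y. y = c) r) = cs"
    using assms by (simp add: w remdups_adj_Cons')
  ultimately show thesis by (rule that)
qed

lemma islands_maximal:
  assumes "(i, j) \<in> islands w" "power_occurrence w i' j'" "i' \<le> i" "j \<le> j'"
  shows "i' = i \<and> j' = j"
  using assms unfolding islands_def mem_Collect_eq prod.case by blast

text \<open>An island is determined by its start, which is \<open>0\<close> or a position where the letter changes.\<close>

lemma height_three_blocks_le:
  "height (replicate a x @ replicate b y @ replicate c z) \<le> 3"
proof -
  let ?w = "replicate a x @ replicate b y @ replicate c z"
  have "inj_on fst (islands ?w)"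
  proof (rule inj_onI)
    fix p q assume p: "p \<in> islands ?w" and q: "q \<in> islands ?w" and eq: "fst p = fst q"
    obtain i j j' where pq: "p = (i, j)" "q = (i, j')"
      using eq by (cases p; cases q) auto
    have "power_occurrence ?w i j" "power_occurrence ?w i j'"
      using p q by (simp_all add: islands_def pq)
    then show "p = q"
      using p q unfolding pq by (metis islands_maximal le_refl nle_le)
  qed
  moreover have "fst ` islands ?w \<subseteq> {0, a, a + b}"
  proof
    fix i assume "i \<in> fst ` islands ?w"
    then obtain j where ij: "(i, j) \<in> islands ?w" by auto
    show "i \<in> {0, a, a + b}"
    \<comment> \<open>A start other than these three has its predecessor in the same block, so the
      occurrence extends to the left, against maximality.\<close>
    proof (rule ccontr)
      assume "i \<notin> {0, a, a + b}"
      then have "i \<noteq> 0" "i \<noteq> a" "i \<noteq> a + b" by auto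
      have occ: "power_occurrence ?w i j"
        using ij by (simp add: islands_def)
      then have "i < j" "j \<le> a + b + c"
        by (auto simp: power_occurrence_def)
      with \<open>i \<noteq> 0\<close> \<open>i \<noteq> a\<close> \<open>i \<noteq> a + b\<close> have prev: "?w ! (i - 1) = ?w ! i"
        by (auto simp: nth_append)
      from occ obtain d where d: "\<forall>k\<in>{i..<j}. ?w ! k = d"
        by (auto simp: power_occurrence_def)
      have "?w ! k = d" if "k \<in> {i - 1..<j}" for k
      proof (cases "k = i - 1")
        case True
        then show ?thesis using prev d \<open>i < j\<close> by simp
      next
        case False
        then have "k \<in> {i..<j}" using that by auto
        then show ?thesis using d by blast
      qed
      then have "power_occurrence ?w (i - 1) j"
        using occ unfolding power_occurrence_def by auto
      then have "i - 1 = i"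
        using islands_maximal[OF ij] by simp
      with \<open>i \<noteq> 0\<close> show False by simp
    qed
  qed
  ultimately have "card (islands ?w) \<le> card {0, a, a + b}"
    by (intro card_inj_on_le) auto
  also have "\<dots> \<le> 3"
    by (simp add: card_insert_if)
  finally show ?thesis by (simp add: height_def)
qed

section \<open>Consequences of property (C\<open>\<^sub>3\<close>)\<close>

text \<open>The form in which (C_3) is applied throughout. Exponents may be zero, so powers of one
  letter are covered too.\<close>

lemma property_C_remdups_adj:
  assumes "property_C 3 mult" "satisfies_identity mult u v" "x \<noteq> y"
    and "u = replicate a x @ replicate b y @ replicate c x"
  shows "remdups_adj u = remdups_adj v"
proof (rule same_type_remdups_adj)
  have "u \<noteq> []" using assms(2) by (simp add: satisfies_identity_def)
  moreover have "set u \<subseteq> {x, y}" using assms(4) by auto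
  moreover have "height u \<le> 3" using height_three_blocks_le assms(4) by simp
  ultimately show "same_type u v"
    using assms(1-3) unfolding property_C_def by blast
qed

text \<open>If \<open>z\<close> occurred only in \<open>v\<close>, sending \<open>z\<close> to 1 and
  all other letters to 0 would make \<open>u\<close> a power of 0 but leave a 1 in
  \<open>v\<close>.\<close>

lemma property_C_content_subset:
  assumes "semigroup mult" "property_C 3 mult" "satisfies_identity mult u v"
  shows "set v \<subseteq> set u"
proof
  fix z assume "z \<in> set v"
  show "z \<in> set u"
  proof (rule ccontr)
    assume "z \<notin> set u"
    define f :: "nat \<Rightarrow> nat" where "f c = (if c = z then 1 else 0)" for c
    have u: "map f u = replicate (length u) 0 @ replicate 0 1 @ replicate 0 0"
      using \<open>z \<notin> set u\<close> by (auto simp: f_def intro!: replicate_eqI)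
    have "remdups_adj (map f u) = remdups_adj (map f v)"
      by (rule property_C_remdups_adj[OF assms(2) satisfies_identity_map[OF assms(1,3)] _ u]) simp
    then have "set (map f u) = set (map f v)"
      by (metis remdups_adj_set)
    moreover have "f z \<in> set (map f v)"
      using \<open>z \<in> set v\<close> by auto
    ultimately show False
      using \<open>z \<notin> set u\<close> by (auto simp: f_def split: if_splits)
  qed
qed

lemma property_C_content_eq:
  assumes "semigroup mult" "property_C 3 mult" "satisfies_identity mult u v"
  shows "set v = set u"
  using property_C_content_subset[OF assms(1,2)] assms(3) satisfies_identity_sym by blast

text \<open>The characteristic function of \<open>A\<close> turns the left side into a word of type
  0, 1, 0. By (C_3) the image of \<open>w\<close> has the same type, and \<open>w\<close> is cut
  where the islands of its image end.\<close>

lemma property_C_block: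
  assumes "semigroup mult" "property_C 3 mult" "satisfies_identity mult (P @ Q @ R) w"
    and "P \<noteq> []" "Q \<noteq> []" "R \<noteq> []"
    and "set P \<inter> A = {}" "set Q \<subseteq> A" "set R \<inter> A = {}"
  obtains P' Q' R' where "w = P' @ Q' @ R'" "set P' \<inter> A = {}" "set Q' \<subseteq> A" "set R' \<inter> A = {}"
proof -
  define f :: "nat \<Rightarrow> nat" where "f c = (if c \<in> A then 1 else 0)" for c
  have "map f P = replicate (length P) 0" "map f Q = replicate (length Q) 1"
    "map f R = replicate (length R) 0"
    using assms(7-9) by (auto simp: f_def intro!: replicate_eqI)
  then have u: "map f (P @ Q @ R) =
      replicate (length P) 0 @ replicate (length Q) 1 @ replicate (length R) 0"
    by simp
  have "remdups_adj (map f (P @ Q @ R)) = remdups_adj (map f w)"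
    by (rule property_C_remdups_adj[OF assms(2) satisfies_identity_map[OF assms(1,3)] _ u]) simp
  moreover have "remdups_adj (map f (P @ Q @ R)) = [0, 1, 0]"
    using remdups_adj_replicate_append[of "length R" "[]" "0::nat"] assms(4-6) unfolding u
    by (simp add: remdups_adj_replicate_append Suc_le_eq)
  ultimately have "remdups_adj (map f w) = [0, 1, 0]" by simp
  then obtain a b c w' where "map f w = replicate a 0 @ replicate b 1 @ replicate c 0 @ w'"
    "remdups_adj w' = []"
    by (metis remdups_adj_eq_ConsE)
  then have "map f w = replicate a 0 @ replicate b 1 @ replicate c 0"
    by simp
  then obtain P' Q' R' where w: "w = P' @ Q' @ R'" "map f P' = replicate a 0"
    "map f Q' = replicate b 1" "map f R' = replicate c 0"
    by (auto simp: map_eq_append_conv append_eq_map_conv)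
  have "f ` set P' \<subseteq> {0}" "f ` set Q' \<subseteq> {1}" "f ` set R' \<subseteq> {0}"
    using arg_cong[OF w(2), of set] arg_cong[OF w(3), of set] arg_cong[OF w(4), of set]
    by (auto split: if_splits)
  then have "set P' \<inter> A = {}" "set Q' \<subseteq> A" "set R' \<inter> A = {}"
    by (auto simp: f_def image_subset_iff split: if_splits)
  with w(1) show thesis by (rule that)
qed

section \<open>Words equal to a framed product\<close>

text \<open>With letters 1, ..., n and frame 0, order of occurrence becomes numerical order and can
  be expressed by \<open>sorted\<close>.\<close>

abbreviation framed_upto :: "nat \<Rightarrow> nat \<Rightarrow> word" where
  "framed_upto k n \<equiv> framed_powers k 0 [1..<Suc n]"

abbreviation nonzero :: "word \<Rightarrow> word" where
  "nonzero \<equiv> filter (\<lambda>c. c \<noteq> 0)"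

lemma set_concat_replicate: "k > 0 \<Longrightarrow> set (concat (map (replicate k) ys)) = set ys"
  by auto

lemma framed_upto_block:
  assumes "semigroup mult" "property_C 3 mult" "satisfies_identity mult (framed_upto k n) w"
    and "k > 0" "1 \<le> i" "i \<le> j" "j \<le> n"
  obtains P Q R where "nonzero w = P @ Q @ R"
    "set P \<inter> {i..j} = {}" "set Q \<subseteq> {i..j}" "set R \<inter> {i..j} = {}"
proof -
  let ?c = "\<lambda>ys. concat (map (replicate k) ys)"
  have "[1..<Suc n] = [1..<i] @ [i..<Suc j] @ [Suc j..<Suc n]"
    using assms(5-7) upt_add_eq_append[of 1 i "Suc n - i"]
      upt_add_eq_append[of i "Suc j" "n - j"] by (simp del: upt_Suc)
  then have "framed_upto k n = (replicate k 0 @ ?c [1..<i]) @ ?c [i..<Suc j] @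
      (?c [Suc j..<Suc n] @ replicate k 0)" (is "_ = ?P @ ?Q @ ?R")
    by (simp add: framed_powers_def del: upt_Suc)
  then have sat: "satisfies_identity mult (?P @ ?Q @ ?R) w"
    using assms(3) by simp
  have ne: "?P \<noteq> []" "?Q \<noteq> []" "?R \<noteq> []"
    using assms(4-7) by auto
  have sets: "set ?P \<inter> {i..j} = {}" "set ?Q \<subseteq> {i..j}" "set ?R \<inter> {i..j} = {}"
    using assms(4-7) by auto
  from property_C_block[OF assms(1,2) sat ne sets]
  obtain P Q R where "w = P @ Q @ R"
    "set P \<inter> {i..j} = {}" "set Q \<subseteq> {i..j}" "set R \<inter> {i..j} = {}"
    by blast
  then show thesis
    by (intro that[of "nonzero P" "nonzero Q" "nonzero R"]) auto
qed

lemma framed_upto_content: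
  assumes "semigroup mult" "property_C 3 mult" "satisfies_identity mult (framed_upto k n) w"
    and "k > 0"
  shows "set (nonzero w) = {1..n}"
proof -
  have "set w = insert 0 {1..n}"
    unfolding property_C_content_eq[OF assms(1-3)] framed_powers_def set_append
      set_concat_replicate[OF assms(4)] using assms(4) by (auto simp: set_replicate_conv_if simp del: upt_Suc)
  then show ?thesis by auto
qed

text \<open>Both the low letters \<open>{1..i}\<close> and the high letters
  \<open>{Suc i..n}\<close> form blocks. If high letters stood on both sides of the low block, the
  high block would reach both ends of \<open>nonzero w\<close> and swallow the letter 1.\<close>

lemma framed_upto_threshold:
  assumes "semigroup mult" "property_C 3 mult" "satisfies_identity mult (framed_upto k n) w"
    and "k > 0" "1 \<le> i" "i < n"
  obtains (incr) P Q where "nonzero w = P @ Q" "P \<noteq> []" "Q \<noteq> []" "\<forall>c\<in>set P. c \<le> i" "\<forall>c\<in>set Q. i < c"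
  | (decr) P Q where "nonzero w = P @ Q" "P \<noteq> []" "Q \<noteq> []" "\<forall>c\<in>set P. i < c" "\<forall>c\<in>set Q. c \<le> i"
proof -
  note content = framed_upto_content[OF assms(1-4)]
  obtain P Q R where low: "nonzero w = P @ Q @ R"
    "set P \<inter> {1..i} = {}" "set Q \<subseteq> {1..i}" "set R \<inter> {1..i} = {}"
    using framed_upto_block[OF assms(1-4), of 1 i] assms(5,6) by auto
  obtain P' Q' R' where high: "nonzero w = P' @ Q' @ R'" "set P' \<inter> {Suc i..n} = {}"
    "set Q' \<subseteq> {Suc i..n}" "set R' \<inter> {Suc i..n} = {}"
    using framed_upto_block[OF assms(1-4), of "Suc i" n] assms(5,6) by auto
  have sub: "set P \<union> set Q \<union> set R = {1..n}"
    using content low(1) by (metis set_append sup_assoc)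
  have PR: "\<forall>c\<in>set P \<union> set R. i < c \<and> c \<le> n"
  proof
    fix c assume c: "c \<in> set P \<union> set R"
    then have "c \<in> {1..n}" "c \<notin> {1..i}" using sub low(2,4) by blast+
    then show "i < c \<and> c \<le> n" by auto
  qed
  have ends: "1 \<in> {1..n}" "n \<in> {1..n}" using assms(5,6) by auto
  have "1 \<notin> set P \<union> set R" using PR assms(5) by (meson leD)
  then have one: "1 \<in> set Q" using ends(1) unfolding sub[symmetric] by blast
  have "n \<notin> set Q" using low(3) assms(6) by auto
  then have top: "n \<in> set P \<union> set R" using ends(2) unfolding sub[symmetric] by blast
  have "P = [] \<or> R = []"
  proof (rule ccontr)
    assume "\<not> (P = [] \<or> R = [])"
    then have "hd (nonzero w) \<in> set P" "last (nonzero w) \<in> set R"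
      unfolding low(1) by simp_all
    then have outer: "hd (nonzero w) \<in> {Suc i..n}" "last (nonzero w) \<in> {Suc i..n}"
      using PR by (auto simp: Suc_le_eq)
    have "P' = []"
      using outer(1) high(2) unfolding high(1) by (cases P') auto
    moreover have "R' = []"
      using outer(2) high(4) unfolding high(1) by (cases R' rule: rev_cases) auto
    ultimately have "set (nonzero w) \<subseteq> {Suc i..n}"
      using high(3) unfolding high(1) by simp
    then have "1 \<in> {Suc i..n}" using ends(1) unfolding content by blast
    then show False using assms(5) by simp
  qed
  then show thesis
  proof
    assume P: "P = []"
    show thesis
    proof (rule incr)
      show "nonzero w = Q @ R" using low(1) P by simp
    qed (use low(3) PR one top P in auto)
  next
    assume R: "R = []"
    show thesis
    proof (rule decr)
      show "nonzero w = P @ Q" using low(1) R by simp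
    qed (use low(3) PR one top R in auto)
  qed
qed

text \<open>An inversion, \<open>a\<close> before a smaller \<open>b\<close>, is caught by the
  threshold \<open>i = b\<close>; if \<open>b = n\<close>, no letter exceeds it.\<close>

lemma sorted_wrt_thresholds:
  fixes xs :: "nat list"
  assumes "set xs \<subseteq> {1..n}"
    and "\<And>i. 1 \<le> i \<Longrightarrow> i < n \<Longrightarrow> sorted_wrt (\<lambda>a b. b \<le> i \<longrightarrow> a \<le> i) xs"
  shows "sorted xs"
  unfolding sorted_wrt_iff_nth_less
proof (intro allI impI)
  fix p q assume pq: "p < q" "q < length xs"
  then have mem: "xs ! p \<in> {1..n}" "xs ! q \<in> {1..n}"
    using assms(1) by (meson in_mono nth_mem order.strict_trans)+
  show "xs ! p \<le> xs ! q"
  proof (cases "xs ! q < n")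
    case True
    then show ?thesis
      using assms(2)[of "xs ! q"] mem pq by (auto simp: sorted_wrt_iff_nth_less)
  next
    case False
    then show ?thesis using mem by auto
  qed
qed

text \<open>If \<open>nonzero w\<close> increased across the threshold \<open>i\<close> and decreased across \<open>j\<close>, then its first and
  last letters would satisfy \<open>hd \<le> i < last \<le> j < hd\<close>.\<close>

lemma framed_upto_monotone:
  assumes "semigroup mult" "property_C 3 mult" "satisfies_identity mult (framed_upto k n) w"
    and "k > 0"
  shows "sorted (nonzero w) \<or> sorted (rev (nonzero w))"
proof -
  let ?xs = "nonzero w"
  let ?incr = "\<lambda>i. sorted_wrt (\<lambda>a b. b \<le> i \<longrightarrow> a \<le> i) ?xs \<and> hd ?xs \<le> i \<and> i < last ?xs"
  let ?decr = "\<lambda>i. sorted_wrt (\<lambda>a b. a \<le> i \<longrightarrow> b \<le> i) ?xs \<and> i < hd ?xs \<and> last ?xs \<le> i"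
  have content: "set ?xs \<subseteq> {1..n}"
    using framed_upto_content[OF assms] by simp
  \<comment> \<open>Serves the two halves \<open>P\<close> and \<open>Q\<close> at a threshold, on
    each of which the relation holds for all pairs.\<close>
  have block: "sorted_wrt R ys" if "\<And>c d. c \<in> set ys \<Longrightarrow> d \<in> set ys \<Longrightarrow> R c d"
    for R and ys :: "nat list"
    using that by (simp add: sorted_wrt_iff_nth_less)
  have dir: "?incr i \<or> ?decr i" if i: "1 \<le> i" "i < n" for i
  proof (rule framed_upto_threshold[OF assms i])
    fix P Q assume *: "?xs = P @ Q" "P \<noteq> []" "Q \<noteq> []" "\<forall>c\<in>set P. c \<le> i" "\<forall>c\<in>set Q. i < c"
    then have "?incr i"
      unfolding *(1) by (force simp: sorted_wrt_append intro!: block)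
    then show ?thesis ..
  next
    fix P Q assume *: "?xs = P @ Q" "P \<noteq> []" "Q \<noteq> []" "\<forall>c\<in>set P. i < c" "\<forall>c\<in>set Q. c \<le> i"
    then have "?decr i"
      unfolding *(1) by (force simp: sorted_wrt_append intro!: block)
    then show ?thesis ..
  qed
  show ?thesis
  proof (cases "\<exists>i. 1 \<le> i \<and> i < n \<and> ?decr i")
    case False
    then have "sorted ?xs"
      using dir content by (intro sorted_wrt_thresholds[of _ n]) blast+
    then show ?thesis ..
  next
    case True
    then obtain j where j: "?decr j" by blast
    have "\<not> ?incr i" for i
      using j by linarith
    then have "?decr i" if "1 \<le> i" "i < n" for i
      using dir[OF that] by blast
    then have "sorted (rev ?xs)"
      using content by (intro sorted_wrt_thresholds[of _ n]) (auto simp: sorted_wrt_rev)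
    then show ?thesis ..
  qed
qed

section \<open>Invariance under identities in few variables\<close>

text \<open>Applied to a factor common to an increasing and a decreasing word, this leaves room for
  only one nonzero letter in it.\<close>

lemma sorted_and_sorted_rev_eq:
  fixes xs :: "nat list"
  assumes "sorted xs" "sorted (rev xs)" "c \<in> set xs" "d \<in> set xs"
  shows "c = d"
proof -
  have "sorted_wrt (\<lambda>x y. y \<le> x) xs"
    using assms(2) unfolding sorted_wrt_rev .
  then have "sorted_wrt (\<lambda>x y. x = y) xs"
    using assms(1) unfolding sorted_wrt_iff_nth_less by (metis order.antisym)
  then show ?thesis
    using assms(3,4) unfolding sorted_wrt_iff_nth_less in_set_conv_nth
    by (metis linorder_neqE_nat)
qed

lemma increasing_step:
  assumes sg: "semigroup mult" and C: "property_C 3 mult" and k: "k > 0"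
    and st: "satisfies_identity mult s t" and card: "card (set s) < n" and n: "n \<ge> 2"
    and ne: "\<And>x. \<sigma> x \<noteq> []"
    and u: "satisfies_identity mult (framed_upto k n) (a @ subst_word \<sigma> s @ b)"
    and inc: "sorted (nonzero (a @ subst_word \<sigma> s @ b))"
  shows "satisfies_identity mult (framed_upto k n) (a @ subst_word \<sigma> t @ b) \<and>
    sorted (nonzero (a @ subst_word \<sigma> t @ b))"
proof -
  let ?u = "a @ subst_word \<sigma> s @ b" and ?v = "a @ subst_word \<sigma> t @ b"
  have v: "satisfies_identity mult (framed_upto k n) ?v"
    using u satisfies_identity_context[OF sg satisfies_identity_subst_word[OF sg st ne]]
    by (rule satisfies_identity_trans)
  have cu: "set (nonzero ?u) = {1..n}" and cv: "set (nonzero ?v) = {1..n}"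
    using framed_upto_content[OF sg C _ k] u v by blast+
  have "sorted (nonzero ?v)"
  proof (rule ccontr)
    assume "\<not> sorted (nonzero ?v)"
    then have dec: "sorted (rev (nonzero ?v))"
      using framed_upto_monotone[OF sg C v k] by blast
    have mem: "1 \<in> set (nonzero ?u)" "n \<in> set (nonzero ?u)"
      "1 \<in> set (nonzero ?v)" "n \<in> set (nonzero ?v)"
      unfolding cu cv using n by auto
    \<comment> \<open>The first nonzero letter of \<open>a\<close> would come first in both words:
      at most 1 in the increasing one, at least \<open>n\<close> in the decreasing one. The last
      letter of \<open>b\<close> is treated symmetrically.\<close>
    have a: "nonzero a = []"
    proof (cases "nonzero a")
      case (Cons c cs)
      have "c \<le> 1"
        using inc mem(1) by (simp only: filter_append Cons append_Cons) auto
      moreover have "n \<le> c"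
        using dec mem(4) by (simp only: filter_append Cons append_Cons rev.simps) (auto simp: sorted_append)
      ultimately show ?thesis using n by simp
    qed simp
    have b: "nonzero b = []"
    proof (cases "nonzero b" rule: rev_cases)
      case (snoc cs c)
      have "n \<le> c"
        using inc mem(2) by (simp only: filter_append snoc) (auto simp: sorted_append)
      moreover have "c \<le> 1"
        using dec mem(3) by (simp only: filter_append snoc rev_append) (auto simp: sorted_append)
      ultimately show ?thesis using n by simp
    qed simp
    have inner: "{1..n} \<subseteq> (\<Union>z\<in>set s. set (nonzero (\<sigma> z)))"
      unfolding cu[symmetric] filter_append a b by (auto simp: set_subst_word)
    have eq: "c = d" if "z \<in> set s" "c \<in> set (nonzero (\<sigma> z))" "d \<in> set (nonzero (\<sigma> z))" for z c d
    proof (rule sorted_and_sorted_rev_eq)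
      obtain p q where "subst_word \<sigma> s = p @ \<sigma> z @ q"
        using \<open>z \<in> set s\<close> by (rule subst_word_factor)
      then show "sorted (nonzero (\<sigma> z))"
        using inc by (simp add: sorted_append)
      have "z \<in> set t"
        using property_C_content_eq[OF sg C st] \<open>z \<in> set s\<close> by simp
      then obtain p q where "subst_word \<sigma> t = p @ \<sigma> z @ q"
        by (rule subst_word_factor)
      then show "sorted (rev (nonzero (\<sigma> z)))"
        using dec by (simp add: sorted_append)
    qed (use that in auto)
    \<comment> \<open>\<open>g\<close> chooses for each nonzero letter a variable of
      \<open>s\<close> whose image contains it; by \<open>eq\<close> no variable is chosen
      twice.\<close>
    define g where "g c = (SOME z. z \<in> set s \<and> c \<in> set (nonzero (\<sigma> z)))" for c
    have g: "g c \<in> set s \<and> c \<in> set (nonzero (\<sigma> (g c)))" if "c \<in> {1..n}" for c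
      unfolding g_def using inner that by (intro someI_ex[of "\<lambda>z. z \<in> set s \<and> c \<in> set (nonzero (\<sigma> z))"]) blast
    have "inj_on g {1..n}"
      by (rule inj_onI) (metis g eq)
    moreover have "g ` {1..n} \<subseteq> set s"
      using g by blast
    ultimately have "card {1..n} \<le> card (set s)"
      by (rule card_inj_on_le) simp
    then show False using card by simp
  qed
  with v show ?thesis by simp
qed

text \<open>The set of pairs \<open>(u, v)\<close> that satisfy the conclusion for all \<open>\<sigma>\<close>, \<open>a\<close>, \<open>b\<close> is a fully invariant
  congruence.\<close>

lemma deducible_preserves:
  assumes "deducible \<Sigma> u v"
    and "\<And>s t a b \<sigma>. (s, t) \<in> \<Sigma> \<Longrightarrow> (\<And>x. \<sigma> x \<noteq> []) \<Longrightarrow>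
      F (a @ subst_word \<sigma> s @ b) \<longleftrightarrow> F (a @ subst_word \<sigma> t @ b)"
    and "\<And>x. \<sigma> x \<noteq> []"
  shows "F (a @ subst_word \<sigma> u @ b) \<longleftrightarrow> F (a @ subst_word \<sigma> v @ b)"
  using assms(1,3)
proof (induction arbitrary: \<sigma> a b)
  case (basis u v)
  then show ?case using assms(2) by blast
next
  case (mult u v u' v')
  have "F (a @ subst_word \<sigma> u @ subst_word \<sigma> u' @ b) \<longleftrightarrow>
      F (a @ subst_word \<sigma> v @ subst_word \<sigma> u' @ b)"
    using mult.IH(1) mult.prems by blast
  \<comment> \<open>The left factor, already rewritten, joins the left context.\<close>
  also have "\<dots> \<longleftrightarrow> F ((a @ subst_word \<sigma> v) @ subst_word \<sigma> v' @ b)"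
    using mult.IH(2)[where a = "a @ subst_word \<sigma> v"] mult.prems by simp
  finally show ?case by (simp add: subst_word_append)
next
  case (subst u v \<tau>)
  then show ?case by (simp add: subst_word_subst_word subst_word_neq_Nil)
qed (simp; blast)+

section \<open>Reversal of framed products and the contradiction\<close>

lemma framed_powers_rev: "framed_powers k x (rev ys) = rev (framed_powers k x ys)"
  by (simp add: framed_powers_def rev_concat rev_map comp_def)

lemma sorted_concat_replicate:
  fixes ys :: "nat list"
  shows "sorted ys \<Longrightarrow> sorted (concat (map (replicate k) ys))"
  by (induction ys) (auto simp: sorted_append)

theorem theorem6p2:
  fixes mult :: "'a \<Rightarrow> 'a \<Rightarrow> 'a"
  assumes "semigroup mult"
    and "property_C 3 mult"
    and "infinite {n. n \<ge> 2 \<and> (\<exists>k \<ge> 2. \<forall>x ys. length ys = n \<and> distinct (x # ys) \<longrightarrow>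
           satisfies_identity mult (framed_powers k x ys) (framed_powers k x (rev ys)))}"
  shows "\<not> finitely_based mult"
proof
  assume "finitely_based mult"
  then obtain \<Sigma> where fin: "finite \<Sigma>"
    and sound: "\<And>s t. (s, t) \<in> \<Sigma> \<Longrightarrow> satisfies_identity mult s t"
    and complete: "\<And>u v. satisfies_identity mult u v \<Longrightarrow> deducible \<Sigma> u v"
    unfolding finitely_based_def by blast
  \<comment> \<open>Counting left sides suffices, as (C_3) gives both sides the same letters. For
    empty \<open>\<Sigma>\<close> the value of \<open>Max\<close> is unspecified and the bound on
    \<open>N\<close> is vacuous.\<close>
  define N where "N = Max ((\<lambda>(s, t). card (set s)) ` \<Sigma>)"
  have N: "card (set s) \<le> N" if "(s, t) \<in> \<Sigma>" for s t
    unfolding N_def using fin that by (intro Max_ge) force+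
  have "\<not> A \<subseteq> {..N}" if "infinite A" for A
    using that finite_subset by blast
  from this[OF assms(3)] obtain n k where n: "n > N" "n \<ge> 2" and k: "k \<ge> 2"
    and rev: "\<And>x ys. length ys = n \<and> distinct (x # ys) \<Longrightarrow>
      satisfies_identity mult (framed_powers k x ys) (framed_powers k x (rev ys))"
    by (auto simp: subset_iff not_le)
  have k0: "k > 0" using k by simp
  let ?U = "framed_upto k n"
  \<comment> \<open>The invariant separating the two sides of the reversal identity: it holds for
    \<open>?U\<close>, while for \<open>rev ?U\<close> it would force \<open>n = 1\<close>.\<close>
  define F where "F w \<longleftrightarrow> satisfies_identity mult ?U w \<and> sorted (nonzero w)" for w
  have UV: "satisfies_identity mult ?U (rev ?U)"
    using rev[of "[1..<Suc n]" 0] by (simp add: framed_powers_rev del: upt_Suc)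
  have step: "F (a @ subst_word \<sigma> s @ b) \<longleftrightarrow> F (a @ subst_word \<sigma> t @ b)"
    if st: "(s, t) \<in> \<Sigma>" and ne: "\<And>x. \<sigma> x \<noteq> []" for s t a b \<sigma>
  proof -
    have sat: "satisfies_identity mult s t" using sound st by blast
    have "card (set s) < n" using N[OF st] n(1) by simp
    moreover from this have "card (set t) < n"
      using property_C_content_eq[OF assms(1,2) sat] by simp
    ultimately show ?thesis
      unfolding F_def
      using increasing_step[OF assms(1,2) k0 sat _ n(2), where \<sigma> = \<sigma>] ne
        increasing_step[OF assms(1,2) k0 satisfies_identity_sym[OF sat] _ n(2), where \<sigma> = \<sigma>]
      by blast
  qed
  \<comment> \<open>Empty contexts and the identity substitution specialise the invariance to the
    two words themselves.\<close>
  have "F ([] @ subst_word (\<lambda>x. [x]) ?U @ []) \<longleftrightarrow> F ([] @ subst_word (\<lambda>x. [x]) (rev ?U) @ [])"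
  proof (rule deducible_preserves[OF complete[OF UV], where F = F])
    show "F (a @ subst_word \<sigma> s @ b) \<longleftrightarrow> F (a @ subst_word \<sigma> t @ b)"
      if "(s, t) \<in> \<Sigma>" "\<And>x. \<sigma> x \<noteq> []" for s t a b \<sigma>
      using that by (rule step)
  qed simp
  then have "F ?U \<longleftrightarrow> F (rev ?U)"
    using subst_word_map[of id] by simp
  moreover have "satisfies_identity mult ?U ?U"
    using UV satisfies_identity_sym satisfies_identity_trans by blast
  moreover have sorted: "sorted (nonzero ?U)"
  proof -
    have "nonzero ?U = concat (map (replicate k) [1..<Suc n])"
      unfolding framed_powers_def by (auto simp: filter_id_conv simp del: upt_Suc)
    then show ?thesis by (simp add: sorted_concat_replicate del: upt_Suc)
  qed
  ultimately have "sorted (rev (nonzero ?U))"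
    by (simp add: F_def rev_filter)
  moreover have "1 \<in> set (nonzero ?U)" "n \<in> set (nonzero ?U)"
    using framed_upto_content[OF assms(1,2) \<open>satisfies_identity mult ?U ?U\<close> k0] n(2) by auto
  ultimately show False
    using sorted_and_sorted_rev_eq[OF sorted, of 1 n] n(2) by linarith
qed

end
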